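(* Let $n\ge 1$ be an integer (of arbitrary parity) and set $k=\lfloor n/2\rfloor$. Then $$P_{\mathrm{VSASM}} = P_{\mathrm{ASM}}\cap P_{\mathrm{VS}}\cap\{X\in\mathbb R^{n\times n} : x_{i,k+1}=(-1)^{i+1}\ \text{for all } i\in[n]\}.$$
   Context: $[n]=\{1,\dots,n\}$. An $n\times n$ alternating sign matrix (ASM) is an $n\times n$ matrix with entries in $\{0,1,-1\}$ such that in each row and each column the non-zero entries alternate in sign and the first and last non-zero entries are $1$ (so every row and column sums to $1$). $P_{\mathrm{ASM}}\subseteq\mathbb R^{n\times n}$ is the convex hull of all $n\times n$ ASMs. $P_{\mathrm{VS}}=\{X\in\mathbb R^{n\times n}: x_{i,j}=x_{i,n+1-j}\ \forall i,j\in[n]\}$. A VSASM (vertically symmetric ASM) is an $n\times n$ ASM lying in $P_{\mathrm{VS}}$, and $P_{\mathrm{VSASM}}$ is the convex hull in $\mathbb R^{n\times n}$ of all $n\times n$ VSASMs (the empty set if there are none). *)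

theory Defs
  imports "HOL-Analysis.Analysis"
begin

text \<open>
  The index set $[n] = \{1, \dots, n\}$ is represented by a finite linearly ordered type of
  cardinality $n$ (such a type is nonempty, so $n \ge 1$); every $n \ge 1$ occurs, for instance
  through the numeral types. The function \<open>idx\<close> is the increasing enumeration of the
  type, starting at position \<open>1\<close>; its values outside \<open>{1..n}\<close> are meaningless.
\<close>

definition idx :: "nat \<Rightarrow> 'n::{finite,linorder}" where
  "idx i = sorted_list_of_set UNIV ! (i - 1)"

lemma bij_betw_idx: "bij_betw idx {1..CARD('n)} (UNIV :: 'n::{finite,linorder} set)"
proof -
  let ?xs = "sorted_list_of_set (UNIV :: 'n set)"
  have "bij_betw ((!) ?xs) {..<CARD('n)} UNIV"
    by (rule bij_betw_nth) auto
  moreover have "bij_betw (\<lambda>i. i - 1) {1..CARD('n)} {..<CARD('n)}"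
    by (rule bij_betw_byWitness[where f' = Suc]) auto
  ultimately have "bij_betw ((!) ?xs \<circ> (\<lambda>i. i - 1)) {1..CARD('n)} UNIV"
    by (rule bij_betw_trans[rotated])
  then show ?thesis
    by (simp add: idx_def[abs_def] comp_def)
qed

lemma idx_less:
  assumes "1 \<le> i" "i < j" "j \<le> CARD('n)"
  shows "(idx i :: 'n::{finite,linorder}) < idx j"
  using assms sorted_wrt_nth_less[OF strict_sorted_list_of_set, of "i - 1" "j - 1" "UNIV :: 'n set"]
  by (auto simp: idx_def)

text \<open>The type \<open>real^'n^'n\<close>, written so that \<open>'n\<close> can carry the sort \<open>{finite,linorder}\<close>.\<close>

type_synonym 'n sq_matrix = "((real, 'n) vec, 'n) vec"

definition entry :: "'n::{finite,linorder} sq_matrix \<Rightarrow> nat \<Rightarrow> nat \<Rightarrow> real" where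
  "entry X i j = X $ idx i $ idx j"

text \<open>
  The sequence \<open>a 1, \<dots>, a n\<close> has a nonzero term, its first and last nonzero terms are
  \<open>1\<close>, and any two consecutive nonzero terms have opposite signs.
\<close>

definition alternating_seq :: "nat \<Rightarrow> (nat \<Rightarrow> real) \<Rightarrow> bool" where
  "alternating_seq n a \<longleftrightarrow>
     (\<exists>i\<in>{1..n}. a i \<noteq> 0) \<and>
     (\<forall>i\<in>{1..n}. a i \<noteq> 0 \<and> (\<forall>l\<in>{1..<i}. a l = 0) \<longrightarrow> a i = 1) \<and>
     (\<forall>i\<in>{1..n}. a i \<noteq> 0 \<and> (\<forall>l\<in>{i<..n}. a l = 0) \<longrightarrow> a i = 1) \<and>
     (\<forall>i\<in>{1..n}. \<forall>j\<in>{1..n}. i < j \<and> a i \<noteq> 0 \<and> a j \<noteq> 0 \<and> (\<forall>l\<in>{i<..<j}. a l = 0)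
        \<longrightarrow> sgn (a j) = - sgn (a i))"

definition is_ASM :: "'n::{finite,linorder} sq_matrix \<Rightarrow> bool" where
  "is_ASM X \<longleftrightarrow>
     (\<forall>i\<in>{1..CARD('n)}. \<forall>j\<in>{1..CARD('n)}. entry X i j \<in> {0, 1, -1}) \<and>
     (\<forall>i\<in>{1..CARD('n)}. alternating_seq CARD('n) (\<lambda>j. entry X i j)) \<and>
     (\<forall>j\<in>{1..CARD('n)}. alternating_seq CARD('n) (\<lambda>i. entry X i j))"

definition P_ASM :: "'n::{finite,linorder} sq_matrix set" where
  "P_ASM = convex hull {X. is_ASM X}"

definition P_VS :: "'n::{finite,linorder} sq_matrix set" where
  "P_VS = {X. \<forall>i\<in>{1..CARD('n)}. \<forall>j\<in>{1..CARD('n)}.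
              entry X i j = entry X i (CARD('n) + 1 - j)}"

definition is_VSASM :: "'n::{finite,linorder} sq_matrix \<Rightarrow> bool" where
  "is_VSASM X \<longleftrightarrow> is_ASM X \<and> X \<in> P_VS"

definition P_VSASM :: "'n::{finite,linorder} sq_matrix set" where
  "P_VSASM = convex hull {X. is_VSASM X}"

end

theory Submission
  imports Defs
begin

text \<open>
  The corner sums \<open>h i j\<close> of a matrix turn the partial-sum inequalities describing the alternating
  sign matrix polytope into difference constraints with integer bounds, and such constraints survive
  the rounding \<open>\<lfloor>h i j + t\<rfloor>\<close> for every \<open>t\<close>. If \<open>X\<close> lies in the right-hand side, then
  the corner sums along the last column of its left half are the integers \<open>i div 2\<close>, so the left half
  can be rounded on its own and reflected, which yields a VSASM for every \<open>0 \<le> t < 1\<close>. Averaging over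
  \<open>t = s / N\<close> recovers \<open>h\<close> as \<open>N \<rightarrow> \<infinity>\<close>, and the convex hull of the finite set of VSASMs
  is closed.
\<close>

section \<open>Alternating sequences and their partial sums\<close>

text \<open>Each nonzero term toggles the partial sum between 0 and 1: the first one, being 1,
  raises it from 0, and the last one, being 1, leaves it at 1. This replaces alternation by
  conditions on linear functionals, which can be carried to convex hulls and rounded.\<close>

lemma alternating_seq_iff_partial_sums:
  assumes "\<forall>i\<in>{1..n}. a i \<in> {0, 1, -1}"
  shows "alternating_seq n a \<longleftrightarrow>
    (\<forall>m\<le>n. (\<Sum>i=1..m. a i) \<in> {0, 1}) \<and> (\<Sum>i=1..n. a i) = 1"
proof
  assume alt: "alternating_seq n a"
  \<comment> \<open>The bound on the partial sum alone would not be inductive. The invariant also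
    records the last nonzero term so far, whose sign determines the partial sum and, by alternation,
    the next nonzero term.\<close>
  have inv: "(\<forall>l\<in>{1..m}. a l = 0) \<and> (\<Sum>i=1..m. a i) = 0 \<or>
      (\<exists>i\<in>{1..m}. a i \<noteq> 0 \<and> (\<forall>l\<in>{i<..m}. a l = 0) \<and>
         (a i = 1 \<and> (\<Sum>i=1..m. a i) = 1 \<or> a i = -1 \<and> (\<Sum>i=1..m. a i) = 0))"
    if "m \<le> n" for m
    using that
  proof (induction m)
    case 0
    then show ?case by simp
  next
    case (Suc m)
    have S: "(\<Sum>i=1..Suc m. a i) = (\<Sum>i=1..m. a i) + a (Suc m)"
      by simp
    have mem: "Suc m \<in> {1..n}"
      using Suc.prems by simp
    show ?case
    proof (cases "a (Suc m) = 0")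
      case True
      have "{1..Suc m} = insert (Suc m) {1..m}" by auto
      moreover have "{i<..Suc m} = insert (Suc m) {i<..m}" if "i \<in> {1..m}" for i
        using that by auto
      ultimately show ?thesis
        using Suc True unfolding S by force
    next
      case nz: False
      have *: ?thesis if "a (Suc m) = 1 \<and> (\<Sum>i=1..m. a i) = 0 \<or> a (Suc m) = -1 \<and> (\<Sum>i=1..m. a i) = 1"
        using that by (intro disjI2 bexI[of _ "Suc m"]) auto
      from Suc have "(\<forall>l\<in>{1..m}. a l = 0) \<and> (\<Sum>i=1..m. a i) = 0 \<or>
        (\<exists>i\<in>{1..m}. a i \<noteq> 0 \<and> (\<forall>l\<in>{i<..m}. a l = 0) \<and>
         (a i = 1 \<and> (\<Sum>i=1..m. a i) = 1 \<or> a i = -1 \<and> (\<Sum>i=1..m. a i) = 0))"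
        by simp
      then show ?thesis
      proof (elim disjE bexE)
        assume A: "(\<forall>l\<in>{1..m}. a l = 0) \<and> (\<Sum>i=1..m. a i) = 0"
        then have "a (Suc m) = 1"
          using alt mem nz unfolding alternating_seq_def by (metis atLeastLessThanSuc_atLeastAtMost)
        then show ?thesis using A * by simp
      next
        fix i assume i: "i \<in> {1..m}" "a i \<noteq> 0 \<and> (\<forall>l\<in>{i<..m}. a l = 0) \<and>
         (a i = 1 \<and> (\<Sum>i=1..m. a i) = 1 \<or> a i = -1 \<and> (\<Sum>i=1..m. a i) = 0)"
        have "{i<..<Suc m} = {i<..m}" by auto
        then have "sgn (a (Suc m)) = - sgn (a i)"
          using alt mem nz i Suc.prems unfolding alternating_seq_def by simp
        moreover have "a (Suc m) \<in> {0, 1, -1}"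
          using assms mem by blast
        ultimately show ?thesis using i * by auto
      qed
    qed
  qed
  have "(\<Sum>i=1..m. a i) \<in> {0, 1}" if "m \<le> n" for m
    using inv[OF that] by auto
  moreover have "(\<Sum>i=1..n. a i) = 1"
  proof -
    have "\<exists>i\<in>{1..n}. a i \<noteq> 0"
      using alt unfolding alternating_seq_def by blast
    then obtain i where i: "i \<in> {1..n}" "a i \<noteq> 0" "\<forall>l\<in>{i<..n}. a l = 0"
      "a i = 1 \<and> (\<Sum>i=1..n. a i) = 1 \<or> a i = -1 \<and> (\<Sum>i=1..n. a i) = 0"
      using inv[of n] by blast
    moreover have "a i = 1"
      using alt i unfolding alternating_seq_def by blast
    ultimately show ?thesis by auto
  qed
  ultimately show "(\<forall>m\<le>n. (\<Sum>i=1..m. a i) \<in> {0, 1}) \<and> (\<Sum>i=1..n. a i) = 1"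
    by blast
next
  assume R: "(\<forall>m\<le>n. (\<Sum>i=1..m. a i) \<in> {0, 1}) \<and> (\<Sum>i=1..n. a i) = 1"
  define S where "S m = (\<Sum>i=1..m. a i)" for m
  have S01: "S m = 0 \<or> S m = 1" if "m \<le> n" for m
    using R that by (auto simp: S_def)
  have Sn: "S n = 1"
    using R by (simp add: S_def)
  have step: "S i = S (i - 1) + a i" if "1 \<le> i" for i
    using that by (cases i) (auto simp: S_def)
  \<comment> \<open>Across a block of zeros \<open>S\<close> is constant, so a nonzero term starts
    from the value left by the previous one. Since \<open>S\<close> takes only the values 0 and 1,
    consecutive nonzero terms must move it in opposite directions.\<close>
  have gap: "S j = S i" if "i \<le> j" "\<forall>l\<in>{i<..j}. a l = 0" for i j
  proof -
    have "{1..j} = {1..i} \<union> {i<..j}" using that(1) by auto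
    then have "S j = S i + (\<Sum>l\<in>{i<..j}. a l)"
      by (simp add: S_def sum.union_disjoint ivl_disj_int)
    then show ?thesis using that(2) by simp
  qed
  have "\<exists>i\<in>{1..n}. a i \<noteq> 0"
  proof (rule ccontr)
    assume "\<not> ?thesis"
    then have "S n = 0" by (simp add: S_def)
    then show False using Sn by simp
  qed
  moreover have "a i = 1" if "i \<in> {1..n}" "a i \<noteq> 0" "\<forall>l\<in>{1..<i}. a l = 0" for i
  proof -
    have "S (i - 1) = S 0" by (rule gap) (use that in auto)
    then show ?thesis
      using step[of i] S01[of i] that by (auto simp: S_def)
  qed
  moreover have "a i = 1" if "i \<in> {1..n}" "a i \<noteq> 0" "\<forall>l\<in>{i<..n}. a l = 0" for i
  proof -
    have "S n = S i" by (rule gap) (use that in auto)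
    then show ?thesis
      using step[of i] S01[of "i - 1"] Sn that by auto
  qed
  moreover have "sgn (a j) = - sgn (a i)"
    if "i \<in> {1..n}" "j \<in> {1..n}" "i < j" "a i \<noteq> 0" "a j \<noteq> 0" "\<forall>l\<in>{i<..<j}. a l = 0" for i j
  proof -
    have "S (j - 1) = S i" by (rule gap) (use that in auto)
    then show ?thesis
      using step[of i] step[of j] S01[of "i - 1"] S01[of i] S01[of j] that by auto
  qed
  ultimately show "alternating_seq n a"
    unfolding alternating_seq_def by blast
qed

lemma ASM_row_partial_sum:
  fixes X :: "'n::{finite,linorder} sq_matrix"
  assumes "is_ASM X" "i \<in> {1..CARD('n)}"
  shows "m \<le> CARD('n) \<Longrightarrow> (\<Sum>j=1..m. entry X i j) \<in> {0, 1}"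
    and "(\<Sum>j=1..CARD('n). entry X i j) = 1"
  using assms alternating_seq_iff_partial_sums[of "CARD('n)" "\<lambda>j. entry X i j"]
  unfolding is_ASM_def by blast+

lemma ASM_column_partial_sum:
  fixes X :: "'n::{finite,linorder} sq_matrix"
  assumes "is_ASM X" "j \<in> {1..CARD('n)}"
  shows "m \<le> CARD('n) \<Longrightarrow> (\<Sum>i=1..m. entry X i j) \<in> {0, 1}"
    and "(\<Sum>i=1..CARD('n). entry X i j) = 1"
  using assms alternating_seq_iff_partial_sums[of "CARD('n)" "\<lambda>i. entry X i j"]
  unfolding is_ASM_def by blast+

section \<open>Linear relations valid on the ASM polytope\<close>

lemma linear_entry: "linear (\<lambda>X. entry X i j)"
  by (rule linearI) (simp_all add: entry_def)

text \<open>The preimage of a convex set under a linear map is convex, so once it contains every ASM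
  it contains their hull. It is applied to partial sums with \<open>S\<close> the unit interval and,
  for complete row and column sums, the singleton of 1.\<close>

lemma linear_in_P_ASM:
  fixes X :: "'n::{finite,linorder} sq_matrix"
  assumes "X \<in> P_ASM" "linear f" "convex S" "\<And>Y :: 'n sq_matrix. is_ASM Y \<Longrightarrow> f Y \<in> S"
  shows "f X \<in> S"
proof -
  have "P_ASM \<subseteq> f -` S"
    unfolding P_ASM_def using assms by (intro hull_minimal convex_linear_vimage) auto
  then show ?thesis using assms(1) by auto
qed

lemma P_ASM_row_partial_sum:
  fixes X :: "'n::{finite,linorder} sq_matrix"
  assumes "X \<in> P_ASM" "i \<in> {1..CARD('n)}"
  shows "m \<le> CARD('n) \<Longrightarrow> (\<Sum>j=1..m. entry X i j) \<in> {0..1}"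
    and "(\<Sum>j=1..CARD('n). entry X i j) = 1"
proof -
  show "(\<Sum>j=1..m. entry X i j) \<in> {0..1}" if "m \<le> CARD('n)"
    by (rule linear_in_P_ASM[OF assms(1), where f = "\<lambda>X. \<Sum>j=1..m. entry X i j"])
      (use ASM_row_partial_sum(1)[OF _ assms(2) that] in
        \<open>force intro: linear_compose_sum linear_entry\<close>)+
  have "(\<Sum>j=1..CARD('n). entry X i j) \<in> {1}"
    by (rule linear_in_P_ASM[OF assms(1), where f = "\<lambda>X. \<Sum>j=1..CARD('n). entry X i j"])
      (use ASM_row_partial_sum(2)[OF _ assms(2)] in
        \<open>force intro: linear_compose_sum linear_entry\<close>)+
  then show "(\<Sum>j=1..CARD('n). entry X i j) = 1" by simp
qed

lemma P_ASM_column_partial_sum: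
  fixes X :: "'n::{finite,linorder} sq_matrix"
  assumes "X \<in> P_ASM" "j \<in> {1..CARD('n)}"
  shows "m \<le> CARD('n) \<Longrightarrow> (\<Sum>i=1..m. entry X i j) \<in> {0..1}"
    and "(\<Sum>i=1..CARD('n). entry X i j) = 1"
proof -
  show "(\<Sum>i=1..m. entry X i j) \<in> {0..1}" if "m \<le> CARD('n)"
    by (rule linear_in_P_ASM[OF assms(1), where f = "\<lambda>X. \<Sum>i=1..m. entry X i j"])
      (use ASM_column_partial_sum(1)[OF _ assms(2) that] in
        \<open>force intro: linear_compose_sum linear_entry\<close>)+
  have "(\<Sum>i=1..CARD('n). entry X i j) \<in> {1}"
    by (rule linear_in_P_ASM[OF assms(1), where f = "\<lambda>X. \<Sum>i=1..CARD('n). entry X i j"])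
      (use ASM_column_partial_sum(2)[OF _ assms(2)] in
        \<open>force intro: linear_compose_sum linear_entry\<close>)+
  then show "(\<Sum>i=1..CARD('n). entry X i j) = 1" by simp
qed

section \<open>Row sums under vertical symmetry and the forced middle column\<close>

lemma P_VS_row_sum_reflect:
  fixes X :: "'n::{finite,linorder} sq_matrix"
  assumes "X \<in> P_VS" "i \<in> {1..CARD('n)}" "m \<le> CARD('n)"
  shows "(\<Sum>j=1..CARD('n) - m. entry X i j) =
    (\<Sum>j=1..CARD('n). entry X i j) - (\<Sum>j=1..m. entry X i j)"
proof -
  let ?n = "CARD('n)"
  have "(\<Sum>j=1..?n - m. entry X i j) = (\<Sum>j\<in>{m<..?n}. entry X i j)"
    by (rule sum.reindex_bij_witness[of _ "\<lambda>j. ?n + 1 - j" "\<lambda>j. ?n + 1 - j"])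
      (use assms in \<open>auto simp: P_VS_def\<close>)
  moreover have "{1..?n} = {1..m} \<union> {m<..?n}"
    using assms(3) by auto
  then have "(\<Sum>j=1..?n. entry X i j) = (\<Sum>j=1..m. entry X i j) + (\<Sum>j\<in>{m<..?n}. entry X i j)"
    by (simp add: sum.union_disjoint ivl_disj_int)
  ultimately show ?thesis by simp
qed

text \<open>Reflect the left half, \<open>m = n div 2\<close>. For even n it is mirrored onto the
  remaining columns, so the row sum 1 splits evenly. For odd n the reflected sum includes one
  further column, the middle one, which receives what the two halves leave over.\<close>

lemma P_VS_row_sum_half:
  fixes X :: "'n::{finite,linorder} sq_matrix"
  assumes "X \<in> P_ASM" "X \<in> P_VS" "i \<in> {1..CARD('n)}"
  shows "even CARD('n) \<Longrightarrow> (\<Sum>j=1..CARD('n) div 2. entry X i j) = 1 / 2"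
    and "odd CARD('n) \<Longrightarrow>
      entry X i (CARD('n) div 2 + 1) = 1 - 2 * (\<Sum>j=1..CARD('n) div 2. entry X i j)"
proof -
  let ?k = "CARD('n) div 2"
  note r = P_VS_row_sum_reflect[OF assms(2,3), of ?k] P_ASM_row_partial_sum(2)[OF assms(1,3)]
  show "(\<Sum>j=1..?k. entry X i j) = 1 / 2" if "even CARD('n)"
  proof -
    have "CARD('n) - ?k = ?k" using that by (auto elim: evenE)
    then show ?thesis using r by simp
  qed
  show "entry X i (?k + 1) = 1 - 2 * (\<Sum>j=1..?k. entry X i j)" if "odd CARD('n)"
  proof -
    have "CARD('n) - ?k = Suc ?k" using that by (auto elim: oddE)
    then show ?thesis using r by simp
  qed
qed

lemma convex_P_VS: "convex P_VS"
  unfolding convex_def P_VS_def entry_def by simp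

lemma convex_fixed_entries: "convex {X. \<forall>i\<in>I. entry X i j = c i}"
proof -
  have "{X. \<forall>i\<in>I. entry X i j = c i} = (\<Inter>i\<in>I. (\<lambda>X. entry X i j) -` {c i})"
    by auto
  also have "convex \<dots>"
    by (intro convex_INT convex_linear_vimage linear_entry) auto
  finally show ?thesis .
qed

text \<open>Even n would give a partial row sum 1/2, which no ASM has. For odd n each middle entry
  is 1 - 2s with s in {0, 1}, so the middle column has no zeros and its signs alternate starting
  from 1.\<close>

lemma VSASM_middle_column:
  fixes X :: "'n::{finite,linorder} sq_matrix"
  assumes "is_VSASM X" "i \<in> {1..CARD('n)}"
  shows "entry X i (CARD('n) div 2 + 1) = (-1) ^ (i + 1)"
proof -
  let ?n = "CARD('n)" and ?k = "CARD('n) div 2"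
  have asm: "is_ASM X" and vs: "X \<in> P_VS"
    using assms(1) by (auto simp: is_VSASM_def)
  have P: "X \<in> P_ASM"
    unfolding P_ASM_def using asm by (simp add: hull_inc)
  have odd: "odd ?n"
  proof
    assume "even ?n"
    then show False
      using P_VS_row_sum_half(1)[OF P vs assms(2)] ASM_row_partial_sum(1)[OF asm assms(2), of ?k]
      by auto
  qed
  then have k: "?k + 1 \<in> {1..?n}" by (auto elim: oddE)
  have pm: "entry X l (?k + 1) = 1 \<or> entry X l (?k + 1) = -1" if "l \<in> {1..?n}" for l
    using P_VS_row_sum_half(2)[OF P vs that odd] ASM_row_partial_sum(1)[OF asm that, of ?k]
    by auto
  \<comment> \<open>A step of 1 or -1 that stays inside {0, 1} has to switch between the two values,
    so the partial column sum is the parity of \<open>m\<close>.\<close>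
  have S: "(\<Sum>l=1..m. entry X l (?k + 1)) = of_bool (odd m)" if "m \<le> ?n" for m
    using that
  proof (induction m)
    case (Suc m)
    then show ?case
      using pm[of "Suc m"] ASM_column_partial_sum(1)[OF asm k, of "Suc m"] by auto
  qed simp
  obtain m where m: "i = Suc m" using assms(2) by (cases i) auto
  then have "entry X i (?k + 1) = of_bool (odd i) - of_bool (odd m)"
    using S[of i] S[of m] assms(2) by simp
  then show ?thesis
    using m by (auto simp: of_bool_def)
qed

section \<open>Finiteness of the set of ASMs\<close>

lemma finite_vec_entries:
  assumes "finite A"
  shows "finite {v :: ('a, 'n::finite) vec. \<forall>q. v $ q \<in> A}"
proof (rule finite_subset)
  show "finite (vec_lambda ` (UNIV \<rightarrow>\<^sub>E A) :: ('a, 'n) vec set)"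
    using assms by (intro finite_imageI finite_PiE) auto
  show "{v :: ('a, 'n) vec. \<forall>q. v $ q \<in> A} \<subseteq> vec_lambda ` (UNIV \<rightarrow>\<^sub>E A)"
    by (auto intro!: image_eqI[where x = "vec_nth _"])
qed

lemma finite_ASM: "finite {X :: 'n::{finite,linorder} sq_matrix. is_ASM X}"
proof (rule finite_subset)
  show "finite {X :: 'n sq_matrix. \<forall>p. X $ p \<in> {v. \<forall>q. v $ q \<in> {0, 1, -1}}}"
    by (intro finite_vec_entries) simp
  show "{X :: 'n sq_matrix. is_ASM X} \<subseteq> {X. \<forall>p. X $ p \<in> {v. \<forall>q. v $ q \<in> {0, 1, -1}}}"
  proof (intro subsetI CollectI allI)
    fix X :: "'n sq_matrix" and p q :: 'n
    assume "X \<in> {X. is_ASM X}"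
    moreover obtain i j where "p = idx i" "q = idx j" "i \<in> {1..CARD('n)}" "j \<in> {1..CARD('n)}"
      using bij_betw_idx[where 'n = 'n] unfolding bij_betw_def by (metis UNIV_I imageE)
    ultimately show "X $ p $ q \<in> {0, 1, -1}"
      unfolding is_ASM_def entry_def by blast
  qed
qed

section \<open>Averages of shifted floors\<close>

text \<open>With \<open>m\<close> the floor of N x, the left side becomes the integer sum
  \<open>q m\<close>. Raising \<open>m\<close> by 1 shifts the summation window, so the difference
  telescopes to (m + N) div N - m div N = 1; together with \<open>q 0 = 0\<close> this makes
  \<open>q\<close> the identity on the integers.\<close>

lemma Hermite_identity:
  fixes x :: real
  assumes "0 < N"
  shows "(\<Sum>s<N. \<lfloor>x + real s / real N\<rfloor>) = \<lfloor>real N * x\<rfloor>"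
proof -
  define q where "q m = (\<Sum>s<N. (m + int s) div int N)" for m
  have step: "q (m + 1) = q m + 1" for m
  proof -
    have "q (m + 1) - q m = (\<Sum>s<N. (m + int (Suc s)) div int N - (m + int s) div int N)"
      unfolding q_def sum_subtractf by (simp add: algebra_simps)
    also have "\<dots> = (m + int N) div int N - m div int N"
      by (subst sum_lessThan_telescope) simp
    also have "\<dots> = 1"
      using assms by simp
    finally show ?thesis by simp
  qed
  have q: "q m = m" for m
  proof (induction m rule: int_induct[of _ 0])
    case base
    show ?case by (simp add: q_def div_pos_pos_trivial)
  next
    case (step1 i)
    then show ?case using step[of i] by simp
  next
    case (step2 i)
    then show ?case using step[of "i - 1"] by simp
  qed
  \<comment> \<open>The floor of y / N depends only on the floor of y, here for y = N x + s.\<close>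
  have "\<lfloor>x + real s / real N\<rfloor> = (\<lfloor>real N * x\<rfloor> + int s) div int N" for s
  proof -
    have "x + real s / real N = (real N * x + real s) / real_of_int (int N)"
      using assms by (simp add: field_simps)
    moreover have "\<lfloor>real N * x + real s\<rfloor> = \<lfloor>real N * x\<rfloor> + int s"
      using floor_add_int[of "real N * x" "int s"] by simp
    ultimately show ?thesis
      by (simp only: floor_divide_real_eq_div of_nat_0_le_iff)
  qed
  then show ?thesis
    using q[of "\<lfloor>real N * x\<rfloor>"] by (simp add: q_def)
qed

text \<open>By Hermite's identity the average is the floor of N x divided by N, which lies between x
  - 1/N and x.\<close>

lemma average_floor_tendsto:
  fixes x :: real
  shows "(\<lambda>N. (\<Sum>s<N. of_int \<lfloor>x + real s / real N\<rfloor>) / real N) \<longlonglongrightarrow> x"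
proof (rule tendsto_sandwich)
  have eq: "(\<Sum>s<N. of_int \<lfloor>x + real s / real N\<rfloor>) / real N = of_int \<lfloor>real N * x\<rfloor> / real N"
    if "0 < N" for N
    unfolding Hermite_identity[OF that, symmetric] by simp
  show "\<forall>\<^sub>F N in sequentially. x - 1 / real N \<le> (\<Sum>s<N. of_int \<lfloor>x + real s / real N\<rfloor>) / real N"
    using eventually_gt_at_top[of 0]
  proof eventually_elim
    case (elim N)
    have "real N * x - 1 \<le> of_int \<lfloor>real N * x\<rfloor>" by linarith
    then have "(real N * x - 1) / real N \<le> of_int \<lfloor>real N * x\<rfloor> / real N"
      by (rule divide_right_mono) simp
    then show ?case unfolding eq[OF elim] using elim by (simp add: diff_divide_distrib)
  qed
  show "\<forall>\<^sub>F N in sequentially. (\<Sum>s<N. of_int \<lfloor>x + real s / real N\<rfloor>) / real N \<le> x"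
    using eventually_gt_at_top[of 0]
  proof eventually_elim
    case (elim N)
    have "of_int \<lfloor>real N * x\<rfloor> \<le> real N * x" by linarith
    then have "of_int \<lfloor>real N * x\<rfloor> / real N \<le> real N * x / real N"
      by (rule divide_right_mono) simp
    then show ?case unfolding eq[OF elim] using elim by simp
  qed
  show "(\<lambda>N. x - 1 / real N) \<longlonglongrightarrow> x"
    using tendsto_diff[OF tendsto_const lim_1_over_n] by simp
qed simp

section \<open>Matrices recovered from corner sums\<close>

text \<open>The inverse of forming corner sums. It is meant for positive \<open>i\<close> and
  \<open>j\<close>, where the truncated subtraction is the true one and index 0 denotes the
  border.\<close>

definition mixed_diff :: "(nat \<Rightarrow> nat \<Rightarrow> real) \<Rightarrow> nat \<Rightarrow> nat \<Rightarrow> real" where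
  "mixed_diff H i j = H i j - H (i - 1) j - H i (j - 1) + H (i - 1) (j - 1)"

definition matrix_of_corner :: "(nat \<Rightarrow> nat \<Rightarrow> real) \<Rightarrow> 'n::{finite,linorder} sq_matrix" where
  "matrix_of_corner H = (\<chi> p q. mixed_diff H
     (inv_into {1..CARD('n)} idx p) (inv_into {1..CARD('n)} idx q))"

lemma entry_matrix_of_corner:
  assumes "i \<in> {1..CARD('n)}" "j \<in> {1..CARD('n)}"
  shows "entry (matrix_of_corner H :: 'n::{finite,linorder} sq_matrix) i j = mixed_diff H i j"
  using assms bij_betw_idx[where 'n = 'n]
  by (simp add: entry_def matrix_of_corner_def bij_betw_def inv_into_f_f)

lemma sum_mixed_diff_row:
  "(\<Sum>j=1..m. mixed_diff H i j) = (H i m - H (i - 1) m) - (H i 0 - H (i - 1) 0)"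
  by (induction m) (auto simp: mixed_diff_def)

lemma sum_mixed_diff_column:
  "(\<Sum>i=1..m. mixed_diff H i j) = (H m j - H m (j - 1)) - (H 0 j - H 0 (j - 1))"
  by (induction m) (auto simp: mixed_diff_def)

text \<open>Partial row and column sums of mixed differences telescope to single steps of
  \<open>H\<close>, given the zero borders. The step conditions thus put all partial sums in {0, 1},
  and the right and bottom borders make the complete sums 1.\<close>

lemma is_ASM_matrix_of_corner:
  fixes H :: "nat \<Rightarrow> nat \<Rightarrow> real"
  defines "n \<equiv> CARD('n::{finite,linorder})"
  assumes left: "\<And>i. i \<le> n \<Longrightarrow> H i 0 = 0" and top: "\<And>j. j \<le> n \<Longrightarrow> H 0 j = 0"
    and right: "\<And>i. i \<le> n \<Longrightarrow> H i n = real i" and bottom: "\<And>j. j \<le> n \<Longrightarrow> H n j = real j"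
    and row: "\<And>i j. i \<in> {1..n} \<Longrightarrow> j \<le> n \<Longrightarrow> H i j - H (i - 1) j \<in> {0, 1}"
    and col: "\<And>i j. i \<le> n \<Longrightarrow> j \<in> {1..n} \<Longrightarrow> H i j - H i (j - 1) \<in> {0, 1}"
  shows "is_ASM (matrix_of_corner H :: 'n sq_matrix)"
proof -
  let ?X = "matrix_of_corner H :: 'n sq_matrix"
  note e = entry_matrix_of_corner[where 'n = 'n, folded n_def]
  have vals: "entry ?X i j \<in> {0, 1, -1}" if "i \<in> {1..n}" "j \<in> {1..n}" for i j
  proof -
    have "j - 1 \<le> n" using that by auto
    then show ?thesis
      using row[of i j] row[of i "j - 1"] that by (auto simp: e mixed_diff_def)
  qed
  have rows: "(\<Sum>j=1..m. entry ?X i j) = H i m - H (i - 1) m" if "i \<in> {1..n}" "m \<le> n" for i m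
  proof -
    have "(\<Sum>j=1..m. entry ?X i j) = (\<Sum>j=1..m. mixed_diff H i j)"
      by (rule sum.cong) (use that in \<open>auto simp: e\<close>)
    then show ?thesis using that by (simp only: sum_mixed_diff_row) (auto simp: left)
  qed
  have cols: "(\<Sum>i=1..m. entry ?X i j) = H m j - H m (j - 1)" if "j \<in> {1..n}" "m \<le> n" for j m
  proof -
    have "(\<Sum>i=1..m. entry ?X i j) = (\<Sum>i=1..m. mixed_diff H i j)"
      by (rule sum.cong) (use that in \<open>auto simp: e\<close>)
    then show ?thesis using that by (simp only: sum_mixed_diff_column) (auto simp: top)
  qed
  have "alternating_seq n (\<lambda>j. entry ?X i j)" if "i \<in> {1..n}" for i
    using that vals row rows right
    by (subst alternating_seq_iff_partial_sums) (auto simp: of_nat_diff)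
  moreover have "alternating_seq n (\<lambda>i. entry ?X i j)" if "j \<in> {1..n}" for j
    using that vals col cols bottom
    by (subst alternating_seq_iff_partial_sums) (auto simp: of_nat_diff)
  ultimately show ?thesis
    unfolding is_ASM_def n_def[symmetric] using vals by blast
qed

section \<open>Rounding the corner sums to a VSASM\<close>

text \<open>Floor is monotone and commutes with adding 1, so y + t \<le> x + t \<le> y + t + 1
  survives rounding.\<close>

lemma floor_step:
  fixes x y t :: real
  assumes "x - y \<in> {0..1}"
  shows "real_of_int \<lfloor>x + t\<rfloor> - real_of_int \<lfloor>y + t\<rfloor> \<in> {0, 1}"
proof -
  have "\<lfloor>y + t\<rfloor> \<le> \<lfloor>x + t\<rfloor>" "\<lfloor>x + t\<rfloor> \<le> \<lfloor>y + t\<rfloor> + 1"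
    using assms by (auto simp: le_floor_iff floor_le_iff; linarith)+
  then have "\<lfloor>x + t\<rfloor> = \<lfloor>y + t\<rfloor> \<or> \<lfloor>x + t\<rfloor> = \<lfloor>y + t\<rfloor> + 1"
    by linarith
  then show ?thesis by auto
qed

definition corner_sum :: "'n::{finite,linorder} sq_matrix \<Rightarrow> nat \<Rightarrow> nat \<Rightarrow> real" where
  "corner_sum X i j = (\<Sum>a=1..i. \<Sum>b=1..j. entry X a b)"

lemma corner_sum_row_step:
  "1 \<le> i \<Longrightarrow> corner_sum X i j - corner_sum X (i - 1) j = (\<Sum>b=1..j. entry X i b)"
  by (cases i) (auto simp: corner_sum_def)

lemma corner_sum_column_step:
  "1 \<le> j \<Longrightarrow> corner_sum X i j - corner_sum X i (j - 1) = (\<Sum>a=1..i. entry X a j)"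
  by (cases j) (auto simp: corner_sum_def sum.distrib)

lemma mixed_diff_corner_sum:
  assumes "1 \<le> i" "1 \<le> j"
  shows "mixed_diff (corner_sum X) i j = entry X i j"
proof -
  have "mixed_diff (corner_sum X) i j = (\<Sum>b=1..j. entry X i b) - (\<Sum>b=1..j-1. entry X i b)"
    using corner_sum_row_step[OF assms(1), of X j] corner_sum_row_step[OF assms(1), of X "j - 1"]
    by (simp add: mixed_diff_def)
  then show ?thesis using assms(2) by (cases j) auto
qed

text \<open>
  Columns right of the middle follow the rule \<open>h i j + h i (n - j) = i\<close> of vertically symmetric matrices.
\<close>

definition round_corner :: "nat \<Rightarrow> (nat \<Rightarrow> nat \<Rightarrow> real) \<Rightarrow> real \<Rightarrow> nat \<Rightarrow> nat \<Rightarrow> real" where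
  "round_corner n h t i j = (if j \<le> n div 2 then of_int \<lfloor>h i j + t\<rfloor>
     else real i - of_int \<lfloor>h i (n - j) + t\<rfloor>)"

text \<open>The left half of row \<open>i\<close> sums to half of 1 minus the middle entry, that is
  0, 1, 0, 1, ... for successive rows; accumulating gives \<open>i div 2\<close>.\<close>

lemma corner_sum_middle:
  fixes X :: "'n::{finite,linorder} sq_matrix"
  assumes "X \<in> P_ASM" "X \<in> P_VS" "odd CARD('n)"
    and mid: "\<And>i. i \<in> {1..CARD('n)} \<Longrightarrow> entry X i (CARD('n) div 2 + 1) = (-1) ^ (i + 1)"
  shows "i \<le> CARD('n) \<Longrightarrow> corner_sum X i (CARD('n) div 2) = real (i div 2)"
proof (induction i)
  case 0
  then show ?case by (simp add: corner_sum_def)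
next
  case (Suc i)
  let ?k = "CARD('n) div 2"
  have "Suc i \<in> {1..CARD('n)}" using Suc.prems by simp
  from P_VS_row_sum_half(2)[OF assms(1,2) this assms(3)] mid[OF this]
  have "(\<Sum>j=1..?k. entry X (Suc i) j) = (1 - (-1) ^ i) / 2" by simp
  then have "corner_sum X (Suc i) ?k = real (i div 2) + (1 - (-1) ^ i) / 2"
    using corner_sum_row_step[of "Suc i" X ?k] Suc by (simp only: diff_Suc_1) linarith
  then show ?case by (cases "even i") (auto elim!: evenE oddE)
qed

text \<open>On the left half the step conditions follow from \<open>floor_step\<close>, and on the
  right half by reflection. The seam between columns k and k + 1 is where the prescribed middle
  column enters.\<close>

lemma is_VSASM_round_corner:
  fixes X :: "'n::{finite,linorder} sq_matrix"
  assumes X: "X \<in> P_ASM" "X \<in> P_VS" and odd: "odd CARD('n)"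
    and mid: "\<And>i. i \<in> {1..CARD('n)} \<Longrightarrow> entry X i (CARD('n) div 2 + 1) = (-1) ^ (i + 1)"
    and t: "0 \<le> t" "t < 1"
  shows "is_VSASM (matrix_of_corner (round_corner CARD('n) (corner_sum X) t) :: 'n sq_matrix)"
proof -
  define n k where "n = CARD('n)" and "k = CARD('n) div 2"
  define h where "h = corner_sum X"
  define H where "H = round_corner n h t"
  have n: "n = 2 * k + 1"
    using odd by (auto simp: n_def k_def)
  \<comment> \<open>Since 0 \<le> t < 1, rounding leaves integers alone; hence the borders and
    column k keep their values.\<close>
  have fl: "\<lfloor>real m + t\<rfloor> = int m" for m
    using t by (simp add: floor_eq_iff)
  have fl0: "\<lfloor>t\<rfloor> = 0" using t by (simp add: floor_eq_iff)
  have hrow: "h i j - h (i - 1) j \<in> {0..1}" if "i \<in> {1..n}" "j \<le> n" for i j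
    using corner_sum_row_step[of i X j] P_ASM_row_partial_sum(1)[OF X(1), of i j] that
    by (simp add: h_def n_def)
  have hcol: "h i j - h i (j - 1) \<in> {0..1}" if "i \<le> n" "j \<in> {1..n}" for i j
    using corner_sum_column_step[of j X i] P_ASM_column_partial_sum(1)[OF X(1), of j i] that
    by (simp add: h_def n_def)
  have hmid: "h i k = real (i div 2)" if "i \<le> n" for i
    using corner_sum_middle[OF X odd mid] that by (simp add: h_def n_def k_def)
  have hbot: "h n j = real j" if "j \<le> n" for j
    using that
  proof (induction j)
    case (Suc j)
    then show ?case
      using corner_sum_column_step[of "Suc j" X n] P_ASM_column_partial_sum(2)[OF X(1), of "Suc j"]
      by (simp add: h_def n_def)
  qed (simp add: h_def corner_sum_def)
  have h0: "h i 0 = 0" "h 0 j = 0" for i j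
    by (simp_all add: h_def corner_sum_def)
  have Hl: "H i j = of_int \<lfloor>h i j + t\<rfloor>" if "j \<le> k" for i j
    using that by (simp add: H_def round_corner_def n)
  \<comment> \<open>The reflection rule holds on both sides: as n is odd, \<open>j \<le> k\<close>
    puts \<open>n - j\<close> in the right half, and reflecting twice returns to
    \<open>j\<close>.\<close>
  have Hr: "H i j = real i - H i (n - j)" if "j \<le> n" for i j
    using that by (auto simp: H_def round_corner_def n)
  have Hmid: "H i k = real (i div 2)" if "i \<le> n" for i
    using that by (simp add: Hl hmid fl)
  have row_left: "H i j - H (i - 1) j \<in> {0, 1}" if "i \<in> {1..n}" "j \<le> k" for i j
    unfolding Hl[OF that(2)] using that n by (intro floor_step hrow) auto
  have col_left: "H i j - H i (j - 1) \<in> {0, 1}" if "i \<le> n" "j \<in> {1..k}" for i j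
    using that n floor_step[OF hcol[of i j], of t] by (auto simp: Hl)
  have asm: "is_ASM (matrix_of_corner H :: 'n sq_matrix)"
  proof (rule is_ASM_matrix_of_corner, fold n_def)
    show "H i 0 = 0" for i by (simp add: Hl h0 fl0)
    show top: "H 0 j = 0" if "j \<le> n" for j
      using that Hr[of j 0] Hl[of j 0] Hl[of "n - j" 0] n by (cases "j \<le> k") (auto simp: h0 fl0)
    show "H i n = real i" for i by (simp add: Hr[of n] Hl h0 fl0)
    show "H n j = real j" if "j \<le> n" for j
    proof (cases "j \<le> k")
      case True
      then show ?thesis using that by (simp add: Hl hbot fl)
    next
      case False
      then have "n - j \<le> k" using n by simp
      then have "H n (n - j) = real (n - j)"
        using hbot[of "n - j"] fl[of "n - j"] by (simp only: Hl of_int_of_nat_eq)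
      then show ?thesis using Hr[OF that, of n] that by (simp add: of_nat_diff)
    qed
    show "H i j - H (i - 1) j \<in> {0, 1}" if "i \<in> {1..n}" "j \<le> n" for i j
    proof (cases "j \<le> k")
      case False
      then have "n - j \<le> k" using n by simp
      \<comment> \<open>By reflection this row step is 1 minus the row step in column
        \<open>n - j\<close>, and {0, 1} is closed under subtraction from 1.\<close>
      then show ?thesis
        using that row_left[of i "n - j"] n Hr[of j i] Hr[of j "i - 1"] by (auto simp: of_nat_diff)
    qed (use that row_left in auto)
    show "H i j - H i (j - 1) \<in> {0, 1}" if "i \<le> n" "j \<in> {1..n}" for i j
    proof -
      consider "j \<le> k" | "j = Suc k" | "Suc k < j" by linarith
      then show ?thesis
      proof cases
        case 2
        \<comment> \<open>Column k + 1 reflects to column k, so the step over the seam is i - 2 (i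
          div 2), the parity of \<open>i\<close>.\<close>
        have "H i j - H i (j - 1) = real i - 2 * real (i div 2)"
          using 2 Hr[of j i] Hmid[OF that(1)] n by simp
        then show ?thesis by (cases "even i") (auto elim!: evenE oddE)
      next
        case 3
        \<comment> \<open>The two terms \<open>i\<close> cancel, and reflection turns the step into
          one inside the left half.\<close>
        have "H i j - H i (j - 1) = H i (n - (j - 1)) - H i (n - (j - 1) - 1)"
          using that 3 n Hr[of j i] Hr[of "j - 1" i] by (simp add: Suc_diff_le)
        moreover have "n - (j - 1) \<in> {1..k}" using that 3 n by auto
        ultimately show ?thesis using col_left[OF that(1)] by metis
      qed (use that col_left in auto)
    qed
  qed
  have "(matrix_of_corner H :: 'n sq_matrix) \<in> P_VS"
    unfolding P_VS_def
  proof (intro CollectI ballI, fold n_def)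
    fix i j assume ij: "i \<in> {1..n}" "j \<in> {1..n}"
    then have "mixed_diff H i j = mixed_diff H i (n + 1 - j)"
      using Hr[of j i] Hr[of "j - 1" i] Hr[of j "i - 1"] Hr[of "j - 1" "i - 1"]
      by (auto simp: mixed_diff_def Suc_diff_le)
    moreover have "n + 1 - j \<in> {1..n}" using ij by auto
    ultimately show "entry (matrix_of_corner H :: 'n sq_matrix) i j =
        entry (matrix_of_corner H :: 'n sq_matrix) i (n + 1 - j)"
      using ij entry_matrix_of_corner[where 'n = 'n, folded n_def, of i j H]
        entry_matrix_of_corner[where 'n = 'n, folded n_def, of i "n + 1 - j" H] by simp
  qed
  with asm show ?thesis
    by (simp add: is_VSASM_def H_def h_def n_def)
qed

section \<open>Recovering the matrix as a limit of averages\<close>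

lemma average_round_corner_tendsto:
  assumes "n div 2 < j \<Longrightarrow> h i j = real i - h i (n - j)"
  shows "(\<lambda>N. (\<Sum>s<N. round_corner n h (real s / real N) i j) / real N) \<longlonglongrightarrow> h i j"
proof (cases "j \<le> n div 2")
  case True
  then show ?thesis
    using average_floor_tendsto[of "h i j"] by (simp add: round_corner_def)
next
  case False
  have "(\<lambda>N. real i - (\<Sum>s<N. of_int \<lfloor>h i (n - j) + real s / real N\<rfloor>) / real N)
      \<longlonglongrightarrow> h i j"
    using tendsto_diff[OF tendsto_const average_floor_tendsto] assms False by simp
  then show ?thesis
  proof (rule Lim_transform_eventually)
    \<comment> \<open>The two sides agree only for positive \<open>N\<close>: at 0 the empty average
      is 0, while the left side is \<open>i\<close>.\<close>
    show "\<forall>\<^sub>F N in sequentially.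
        real i - (\<Sum>s<N. of_int \<lfloor>h i (n - j) + real s / real N\<rfloor>) / real N =
        (\<Sum>s<N. round_corner n h (real s / real N) i j) / real N"
      using eventually_gt_at_top[of 0]
      by eventually_elim (use False in \<open>simp add: round_corner_def sum_subtractf field_simps\<close>)
  qed
qed

lemma mem_P_VSASM:
  fixes X :: "'n::{finite,linorder} sq_matrix"
  assumes X: "X \<in> P_ASM" "X \<in> P_VS" and odd: "odd CARD('n)"
    and mid: "\<And>i. i \<in> {1..CARD('n)} \<Longrightarrow> entry X i (CARD('n) div 2 + 1) = (-1) ^ (i + 1)"
  shows "X \<in> P_VSASM"
proof -
  let ?n = "CARD('n)" and ?h = "corner_sum X"
  define Y where "Y N s = (matrix_of_corner (round_corner ?n ?h (real s / real N)) :: 'n sq_matrix)"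
    for N s
  define A where "A N = (\<Sum>s<N. (1 / real N) *\<^sub>R Y N s)" for N
  have mem: "A N \<in> P_VSASM" if "0 < N" for N
    unfolding A_def
  proof (rule convex_sum)
    show "Y N s \<in> P_VSASM" if "s \<in> {..<N}" for s
      unfolding P_VSASM_def Y_def using that
      by (intro hull_inc CollectI is_VSASM_round_corner X odd mid) auto
  qed (use that in \<open>auto simp: P_VSASM_def\<close>)
  \<comment> \<open>The symmetry rule for corner sums: each of the first \<open>i\<close> rows has
    sum 1, so its first \<open>n - j\<close> entries complement its first \<open>j\<close>.\<close>
  have reflect: "?h i j = real i - ?h i (?n - j)" if "i \<le> ?n" "j \<le> ?n" for i j
  proof -
    have "?h i (?n - j) = (\<Sum>a=1..i. 1 - (\<Sum>b=1..j. entry X a b))"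
      unfolding corner_sum_def
    proof (rule sum.cong)
      fix a assume "a \<in> {1..i}"
      then have a: "a \<in> {1..?n}" using that by auto
      show "(\<Sum>b=1..?n - j. entry X a b) = 1 - (\<Sum>b=1..j. entry X a b)"
        using P_VS_row_sum_reflect[OF X(2) a that(2)] P_ASM_row_partial_sum(2)[OF X(1) a] by simp
    qed simp
    then show ?thesis by (simp add: corner_sum_def sum_subtractf)
  qed
  have "A \<longlonglongrightarrow> X"
  proof (intro vec_tendstoI)
    fix p q :: 'n
    obtain i j where ij: "p = idx i" "q = idx j" "i \<in> {1..?n}" "j \<in> {1..?n}"
      using bij_betw_idx[where 'n = 'n] unfolding bij_betw_def by (metis UNIV_I imageE)
    let ?R = "\<lambda>a b N. (\<Sum>s<N. round_corner ?n ?h (real s / real N) a b) / real N"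
    have lim: "?R a b \<longlonglongrightarrow> ?h a b" if "a \<le> ?n" "b \<le> ?n" for a b
      by (rule average_round_corner_tendsto) (rule reflect[OF that])
    have "(\<lambda>N. ?R i j N - ?R (i - 1) j N - ?R i (j - 1) N + ?R (i - 1) (j - 1) N)
        \<longlonglongrightarrow> mixed_diff ?h i j"
      unfolding mixed_diff_def using ij by (intro tendsto_intros lim) auto
    \<comment> \<open>\<open>mixed_diff\<close> is linear in its corner function, so averaging
      matrices amounts to averaging the four corner values.\<close>
    moreover have "A N $ p $ q =
        ?R i j N - ?R (i - 1) j N - ?R i (j - 1) N + ?R (i - 1) (j - 1) N" for N
    proof -
      have "A N $ p $ q = (\<Sum>s<N. entry (Y N s) i j / real N)"
        by (simp add: A_def entry_def ij)
      also have "\<dots> = (\<Sum>s<N. mixed_diff (round_corner ?n ?h (real s / real N)) i j / real N)"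
        using ij by (simp add: Y_def entry_matrix_of_corner)
      finally show ?thesis
        by (simp add: mixed_diff_def sum_subtractf sum.distrib sum_divide_distrib
            add_divide_distrib diff_divide_distrib)
    qed
    moreover have "mixed_diff ?h i j = X $ p $ q"
      using ij by (simp add: mixed_diff_corner_sum entry_def)
    ultimately show "(\<lambda>N. A N $ p $ q) \<longlonglongrightarrow> X $ p $ q" by simp
  qed
  moreover have "closed (P_VSASM :: 'n sq_matrix set)"
    unfolding P_VSASM_def
    by (intro compact_imp_closed finite_imp_compact_convex_hull finite_subset[OF _ finite_ASM])
      (auto simp: is_VSASM_def)
  moreover have "\<forall>\<^sub>F N in sequentially. A N \<in> P_VSASM"
    using eventually_gt_at_top[of 0] by eventually_elim (rule mem)
  ultimately show ?thesis
    by (intro Lim_in_closed_set[of P_VSASM A sequentially X]) auto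
qed

section \<open>Equality of the two polytopes\<close>

theorem theorem3p6:
  fixes n k :: nat
  assumes "n = CARD('n::{finite,linorder})"
    and "k = n div 2"
  shows "(P_VSASM :: 'n sq_matrix set) =
    P_ASM \<inter> P_VS \<inter> {X. \<forall>i\<in>{1..n}. entry X i (k + 1) = (-1) ^ (i + 1)}"
proof
  show "(P_VSASM :: 'n sq_matrix set) \<subseteq>
    P_ASM \<inter> P_VS \<inter> {X. \<forall>i\<in>{1..n}. entry X i (k + 1) = (-1) ^ (i + 1)}"
    unfolding P_VSASM_def
  proof (rule hull_minimal)
    show "{X :: 'n sq_matrix. is_VSASM X} \<subseteq>
      P_ASM \<inter> P_VS \<inter> {X. \<forall>i\<in>{1..n}. entry X i (k + 1) = (-1) ^ (i + 1)}"
      using VSASM_middle_column[where 'n = 'n] assms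
      by (auto simp: is_VSASM_def P_ASM_def hull_inc)
    show "convex ((P_ASM :: 'n sq_matrix set) \<inter> P_VS \<inter>
      {X. \<forall>i\<in>{1..n}. entry X i (k + 1) = (-1) ^ (i + 1)})"
      by (intro convex_Int convex_P_VS convex_fixed_entries) (simp add: P_ASM_def)
  qed
  show "P_ASM \<inter> P_VS \<inter> {X. \<forall>i\<in>{1..n}. entry X i (k + 1) = (-1) ^ (i + 1)} \<subseteq>
    (P_VSASM :: 'n sq_matrix set)"
  proof
    fix X :: "'n sq_matrix"
    assume "X \<in> P_ASM \<inter> P_VS \<inter> {X. \<forall>i\<in>{1..n}. entry X i (k + 1) = (-1) ^ (i + 1)}"
    then have X: "X \<in> P_ASM" "X \<in> P_VS"
      and mid: "\<And>i. i \<in> {1..CARD('n)} \<Longrightarrow> entry X i (CARD('n) div 2 + 1) = (-1) ^ (i + 1)"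
      using assms by auto
    \<comment> \<open>For even n the right-hand side is empty: in the first row the left half sums
      to 1/2 and the next entry is 1, so a partial sum would be 3/2 > 1.\<close>
    have "odd CARD('n)"
    proof
      assume ev: "even CARD('n)"
      have one: "1 \<in> {1..CARD('n)}" by (simp add: Suc_leI)
      have "Suc (CARD('n) div 2) \<le> CARD('n)"
        using one ev unfolding atLeastAtMost_iff by presburger
      then show False
        using P_VS_row_sum_half(1)[OF X one ev] mid[OF one]
          P_ASM_row_partial_sum(1)[OF X(1) one, of "Suc (CARD('n) div 2)"] by simp
    qed
    then show "X \<in> P_VSASM" by (rule mem_P_VSASM[OF X _ mid])
  qed
qed

end
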